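(* For every $\alpha\in Fm''$: if $\models_{\cal TML}\alpha$, then $\vdash_{\mathbb T}\alpha$.
   Context: $M_4=\{\mathbf 0,\mathbf n,\mathbf b,\mathbf 1\}$ with $\neg\mathbf 0=\mathbf 1$, $\neg\mathbf 1=\mathbf 0$, $\neg\mathbf n=\mathbf n$, $\neg\mathbf b=\mathbf b$ and $\succ$: $\mathbf 0\succ y=\mathbf 1$; $\mathbf n\succ\mathbf 0=\mathbf n$, $\mathbf n\succ\mathbf n=\mathbf 1$, $\mathbf n\succ\mathbf b=\mathbf b$, $\mathbf n\succ\mathbf 1=\mathbf 1$; $\mathbf b\succ\mathbf 0=\mathbf b$, $\mathbf b\succ\mathbf n=\mathbf n$, $\mathbf b\succ\mathbf b=\mathbf 1$, $\mathbf b\succ\mathbf 1=\mathbf 1$; $\mathbf 1\succ y=y$. Formulas of $Fm''$ are built from propositional variables with $\neg$, $\succ$; a valuation is a homomorphism $h:Fm''\to M_4$; $\models_{\cal TML}\alpha$ means $h(\alpha)=\mathbf 1$ for every valuation $h$. Signed formulas are $T(\alpha)$, $F(\alpha)$. Rules of $\mathbb T$ (premise $\Rightarrow$ conclusion sets separated by $|$): $T(\alpha\succ\beta)\Rightarrow \{T(\beta)\}\,|\,\{T(\neg\alpha),F(\beta),T(\neg\beta)\}\,|\,\{F(\alpha),F(\beta),F(\neg\beta)\}$; $F(\alpha\succ\beta)\Rightarrow\{T(\alpha),F(\beta),F(\neg\beta)\}\,|\,\{F(\neg\alpha),F(\beta),T(\neg\beta)\}$; $T(\neg(\alpha\succ\beta))\Rightarrow\{T(\alpha),F(\beta),T(\neg\beta)\}\,|\,\{F(\neg\alpha),T(\beta),T(\neg\beta)\}$;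 $F(\neg(\alpha\succ\beta))\Rightarrow\{F(\neg\beta)\}\,|\,\{T(\neg\alpha),T(\beta),T(\neg\beta)\}\,|\,\{F(\alpha),F(\beta),T(\neg\beta)\}$; $T(\neg\neg\alpha)\Rightarrow\{T(\alpha)\}$; $F(\neg\neg\alpha)\Rightarrow\{F(\alpha)\}$. A tableau for $\eta$ is a finite tree with root $\eta$ built by repeatedly choosing a non-closed branch and a signed formula on it that is a rule premise, and extending the branch by one sub-branch per conclusion set. A branch is closed if it contains $T(\gamma)$ and $F(\gamma)$ for some $\gamma$; a tableau is closed if all branches are closed. $\vdash_{\mathbb T}\alpha$ means there exists a closed tableau for $F(\alpha)$. *)

theory Defs
  imports Main
begin

datatype m4 = Zero4 | N4 | B4 | One4

fun neg4 :: "m4 \<Rightarrow> m4" where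
  "neg4 Zero4 = One4"
| "neg4 One4 = Zero4"
| "neg4 N4 = N4"
| "neg4 B4 = B4"

fun imp4 :: "m4 \<Rightarrow> m4 \<Rightarrow> m4" where
  "imp4 Zero4 y = One4"
| "imp4 N4 Zero4 = N4"
| "imp4 N4 N4 = One4"
| "imp4 N4 B4 = B4"
| "imp4 N4 One4 = One4"
| "imp4 B4 Zero4 = B4"
| "imp4 B4 N4 = N4"
| "imp4 B4 B4 = One4"
| "imp4 B4 One4 = One4"
| "imp4 One4 y = y"

text \<open>The set of propositional variables is the arbitrary type \<open>'v\<close>.\<close>

datatype 'v fm =
    Var 'v
  | Neg "'v fm"  (\<open>\<sim> _\<close> [80] 80)
  | Imp "'v fm" "'v fm"  (infixr \<open>\<succ>\<close> 70)

definition valuation :: "('v fm \<Rightarrow> m4) \<Rightarrow> bool" where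
  "valuation h \<longleftrightarrow>
     (\<forall>\<alpha>. h (\<sim> \<alpha>) = neg4 (h \<alpha>)) \<and> (\<forall>\<alpha> \<beta>. h (\<alpha> \<succ> \<beta>) = imp4 (h \<alpha>) (h \<beta>))"

definition tml_valid :: "'v fm \<Rightarrow> bool"  (\<open>\<Turnstile>\<^sub>T\<^sub>M\<^sub>L _\<close> [50] 50) where
  "\<Turnstile>\<^sub>T\<^sub>M\<^sub>L \<alpha> \<longleftrightarrow> (\<forall>h. valuation h \<longrightarrow> h \<alpha> = One4)"

datatype 'v sfm = T "'v fm" | F "'v fm"

text \<open>\<open>tableau_rule \<sigma> Cs\<close>: a rule has premise \<open>\<sigma>\<close> and the conclusion sets listed in \<open>Cs\<close>.\<close>

inductive tableau_rule :: "'v sfm \<Rightarrow> 'v sfm set list \<Rightarrow> bool" where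
  T_Imp: "tableau_rule (T (\<alpha> \<succ> \<beta>))
    [{T \<beta>}, {T (\<sim> \<alpha>), F \<beta>, T (\<sim> \<beta>)}, {F \<alpha>, F \<beta>, F (\<sim> \<beta>)}]"
| F_Imp: "tableau_rule (F (\<alpha> \<succ> \<beta>))
    [{T \<alpha>, F \<beta>, F (\<sim> \<beta>)}, {F (\<sim> \<alpha>), F \<beta>, T (\<sim> \<beta>)}]"
| T_Neg_Imp: "tableau_rule (T (\<sim> (\<alpha> \<succ> \<beta>)))
    [{T \<alpha>, F \<beta>, T (\<sim> \<beta>)}, {F (\<sim> \<alpha>), T \<beta>, T (\<sim> \<beta>)}]"
| F_Neg_Imp: "tableau_rule (F (\<sim> (\<alpha> \<succ> \<beta>)))
    [{F (\<sim> \<beta>)}, {T (\<sim> \<alpha>), T \<beta>, T (\<sim> \<beta>)}, {F \<alpha>, F \<beta>, T (\<sim> \<beta>)}]"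
| T_Neg_Neg: "tableau_rule (T (\<sim> \<sim> \<alpha>)) [{T \<alpha>}]"
| F_Neg_Neg: "tableau_rule (F (\<sim> \<sim> \<alpha>)) [{F \<alpha>}]"

datatype 'a tree = Node 'a "'a tree list"

fun branches :: "'a tree \<Rightarrow> 'a list set" where
  "branches (Node x ts) =
     (if ts = [] then {[x]} else (\<Union>t \<in> set ts. (\<lambda>b. x # b) ` branches t))"

definition closed_branch :: "'v sfm list \<Rightarrow> bool" where
  "closed_branch b \<longleftrightarrow> (\<exists>\<gamma>. T \<gamma> \<in> set b \<and> F \<gamma> \<in> set b)"

text \<open>\<open>sub_branch C t\<close>: \<open>t\<close> is a non-branching tree whose nodes enumerate the
  finite set \<open>C\<close> without repetition, in some order.\<close>

inductive sub_branch :: "'a set \<Rightarrow> 'a tree \<Rightarrow> bool" where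
  single: "sub_branch {x} (Node x [])"
| step: "x \<notin> C \<Longrightarrow> sub_branch C t \<Longrightarrow> sub_branch (insert x C) (Node x [t])"

text \<open>\<open>extends b t t'\<close>: the tree \<open>t'\<close> arises from \<open>t\<close> by one rule application at the end of
  one branch of \<open>t\<close>. Here \<open>t\<close> is viewed as a subtree of a larger tree, and \<open>b\<close> lists
  the signed formulas on the path from the root of the larger tree down to, but excluding,
  the root of \<open>t\<close>.\<close>

inductive extends :: "'v sfm list \<Rightarrow> 'v sfm tree \<Rightarrow> 'v sfm tree \<Rightarrow> bool" where
  leaf: "\<not> closed_branch (b @ [x]) \<Longrightarrow> \<sigma> \<in> set (b @ [x]) \<Longrightarrow> tableau_rule \<sigma> Cs \<Longrightarrow>
    list_all2 sub_branch Cs ts \<Longrightarrow> extends b (Node x []) (Node x ts)"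
| inner: "extends (b @ [x]) t t' \<Longrightarrow>
    extends b (Node x (us @ t # vs)) (Node x (us @ t' # vs))"

inductive tableau :: "'v sfm \<Rightarrow> 'v sfm tree \<Rightarrow> bool" for \<eta> where
  root: "tableau \<eta> (Node \<eta> [])"
| extend: "tableau \<eta> t \<Longrightarrow> extends [] t t' \<Longrightarrow> tableau \<eta> t'"

definition closed_tableau :: "'v sfm tree \<Rightarrow> bool" where
  "closed_tableau t \<longleftrightarrow> (\<forall>b \<in> branches t. closed_branch b)"

definition tableau_provable :: "'v fm \<Rightarrow> bool"  (\<open>\<turnstile>\<^sub>T _\<close> [50] 50) where
  "\<turnstile>\<^sub>T \<alpha> \<longleftrightarrow> (\<exists>t. tableau (F \<alpha>) t \<and> closed_tableau t)"

end

theory Submission imports Defs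
begin

text \<open>
  Read \<open>T \<phi>\<close> as ``the value of \<open>\<phi>\<close> is \<open>\<^bold>b\<close> or \<open>\<^bold>1\<close>'' and \<open>F \<phi>\<close> as its negation. Under this
  reading the premise of a rule is equivalent to the disjunction of its conclusion sets, and the
  conclusions are shorter than the premise. Hence a set of signed formulas that is free of clashes
  and saturated under the rules is satisfied by the valuation read off its literals. If a signed
  formula \<open>\<sigma>\<close> is unsatisfiable, then no branch starting from \<open>\<sigma>\<close> lies in such a set, so every
  non-closed branch admits a rule application that adds a new formula to each of its extensions.
  By the decrease in length only finitely many signed formulas arise from \<open>\<sigma>\<close>, so this stops, and
  it stops with a closed tableau.
\<close>

section \<open>Semantics of signed formulas\<close>

definition designated :: "m4 \<Rightarrow> bool" where
  "designated a \<longleftrightarrow> a = B4 \<or> a = One4"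

lemma neg4_neg4: "neg4 (neg4 a) = a"
  by (cases a) simp_all

lemma designated_imp4_iff:
  "designated (imp4 a b) \<longleftrightarrow>
    designated b \<or> (if designated (neg4 b) then designated (neg4 a) else \<not> designated a)"
  by (cases a; cases b) (simp_all add: designated_def)

lemma designated_neg4_imp4_iff:
  "designated (neg4 (imp4 a b)) \<longleftrightarrow>
    designated (neg4 b) \<and> (if designated b then \<not> designated (neg4 a) else designated a)"
  by (cases a; cases b) (simp_all add: designated_def)

primrec satisfies :: "('v fm \<Rightarrow> m4) \<Rightarrow> 'v sfm \<Rightarrow> bool" where
  "satisfies h (T \<phi>) \<longleftrightarrow> designated (h \<phi>)"
| "satisfies h (F \<phi>) \<longleftrightarrow> \<not> designated (h \<phi>)"

lemma satisfies_tableau_rule_iff: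
  assumes "valuation h" and "tableau_rule \<sigma> Cs"
  shows "satisfies h \<sigma> \<longleftrightarrow> (\<exists>C \<in> set Cs. \<forall>\<tau> \<in> C. satisfies h \<tau>)"
proof -
  have h_hom: "h (\<sim> \<phi>) = neg4 (h \<phi>)" "h (\<phi> \<succ> \<psi>) = imp4 (h \<phi>) (h \<psi>)" for \<phi> \<psi>
    using assms(1) by (simp_all add: valuation_def)
  show ?thesis
    using assms(2)
    by cases (auto simp: h_hom neg4_neg4 designated_imp4_iff designated_neg4_imp4_iff)
qed

primrec eval :: "('v \<Rightarrow> m4) \<Rightarrow> 'v fm \<Rightarrow> m4" where
  "eval v (Var p) = v p"
| "eval v (\<sim> \<phi>) = neg4 (eval v \<phi>)"
| "eval v (\<phi> \<succ> \<psi>) = imp4 (eval v \<phi>) (eval v \<psi>)"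

lemma valuation_eval: "valuation (eval v)"
  by (simp add: valuation_def)

section \<open>Signed formulas arising by rule applications\<close>

primrec fm_length :: "'v fm \<Rightarrow> nat" where
  "fm_length (Var p) = 1"
| "fm_length (\<sim> \<phi>) = fm_length \<phi> + 1"
| "fm_length (\<phi> \<succ> \<psi>) = fm_length \<phi> + fm_length \<psi> + 1"

primrec sfm_length :: "'v sfm \<Rightarrow> nat" where
  "sfm_length (T \<phi>) = fm_length \<phi>"
| "sfm_length (F \<phi>) = fm_length \<phi>"

lemma fm_length_pos: "0 < fm_length \<phi>"
  by (cases \<phi>) simp_all

definition conclusion :: "'v sfm \<Rightarrow> 'v sfm \<Rightarrow> bool" where
  "conclusion \<sigma> \<tau> \<longleftrightarrow> (\<exists>Cs. tableau_rule \<sigma> Cs \<and> \<tau> \<in> \<Union> (set Cs))"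

lemma conclusionI:
  assumes "tableau_rule \<sigma> Cs" and "C \<in> set Cs" and "\<tau> \<in> C"
  shows "conclusion \<sigma> \<tau>"
  using assms unfolding conclusion_def by blast

lemma sfm_length_conclusion:
  assumes "conclusion \<sigma> \<tau>"
  shows "sfm_length \<tau> < sfm_length \<sigma>"
proof -
  obtain Cs where "tableau_rule \<sigma> Cs" "\<tau> \<in> \<Union> (set Cs)"
    using assms unfolding conclusion_def by blast
  then show ?thesis
    by cases (auto simp: fm_length_pos)
qed

lemma tableau_rule_unique:
  assumes "tableau_rule \<sigma> Cs" and "tableau_rule \<sigma> Cs'"
  shows "Cs = Cs'"
  using assms(1) by cases (use assms(2) in \<open>cases; simp\<close>)+

lemma tableau_rule_finite:
  assumes "tableau_rule \<sigma> Cs" and "C \<in> set Cs"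
  shows "finite C"
  using assms by cases auto

lemma tableau_rule_nonempty:
  assumes "tableau_rule \<sigma> Cs"
  shows "Cs \<noteq> []" and "{} \<notin> set Cs"
  using assms by (cases; simp)+

lemma finite_conclusions: "finite {\<tau>. conclusion \<sigma> \<tau>}"
proof (cases "\<exists>Cs. tableau_rule \<sigma> Cs")
  case True
  then obtain Cs where rule: "tableau_rule \<sigma> Cs" ..
  then have "{\<tau>. conclusion \<sigma> \<tau>} = \<Union> (set Cs)"
    unfolding conclusion_def using tableau_rule_unique by blast
  then show ?thesis
    using tableau_rule_finite[OF rule] by simp
qed (simp add: conclusion_def)

lemma finite_reachable:
  fixes R :: "'a \<Rightarrow> 'a \<Rightarrow> bool"
  assumes "wfp R\<inverse>\<inverse>" and "\<And>x. finite {y. R x y}"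
  shows "finite {y. R\<^sup>*\<^sup>* x y}"
  using assms(1)
proof (induction x rule: wfp_induct_rule)
  case (less x)
  have "{y. R\<^sup>*\<^sup>* x y} = insert x (\<Union>z \<in> {z. R x z}. {y. R\<^sup>*\<^sup>* z y})"
    by (auto elim: converse_rtranclpE intro: converse_rtranclp_into_rtranclp)
  then show ?case
    using assms(2) less.IH by simp
qed

lemma finite_iterated_conclusions: "finite {\<tau>. conclusion\<^sup>*\<^sup>* \<sigma> \<tau>}"
proof (rule finite_reachable)
  show "wfp conclusion\<inverse>\<inverse>"
    by (rule wfp_if_convertible_to_nat[of _ sfm_length]) (simp add: sfm_length_conclusion)
qed (rule finite_conclusions)

section \<open>Hintikka sets\<close>

definition hintikka :: "'v sfm set \<Rightarrow> bool" where
  "hintikka H \<longleftrightarrow> (\<forall>\<gamma>. \<not> (T \<gamma> \<in> H \<and> F \<gamma> \<in> H)) \<and>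
     (\<forall>\<sigma> \<in> H. \<forall>Cs. tableau_rule \<sigma> Cs \<longrightarrow> (\<exists>C \<in> set Cs. C \<subseteq> H))"

definition hintikka_assignment :: "'v sfm set \<Rightarrow> 'v \<Rightarrow> m4" where
  "hintikka_assignment H p =
     (if T (Var p) \<in> H then (if T (\<sim> Var p) \<in> H then B4 else One4)
      else (if T (\<sim> Var p) \<in> H then Zero4 else N4))"

lemma sfm_rule_or_literal_cases:
  obtains (rule) Cs where "tableau_rule \<sigma> Cs"
  | (literal) p where "\<sigma> \<in> {T (Var p), F (Var p), T (\<sim> Var p), F (\<sim> Var p)}"
proof -
  obtain \<phi> where sign: "\<sigma> = T \<phi> \<or> \<sigma> = F \<phi>"
    by (cases \<sigma>) auto
  consider p where "\<phi> = Var p" | p where "\<phi> = \<sim> Var p" | \<psi> where "\<phi> = \<sim> \<sim> \<psi>"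
    | \<psi> \<chi> where "\<phi> = \<sim> (\<psi> \<succ> \<chi>)" | \<psi> \<chi> where "\<phi> = \<psi> \<succ> \<chi>"
  proof (cases \<phi>)
    case (Neg \<psi>)
    then show ?thesis
      using that by (cases \<psi>) auto
  qed (use that in auto)
  then show ?thesis
    by cases (use sign literal rule tableau_rule.intros in blast)+
qed

lemma hintikka_satisfies_literal:
  assumes "hintikka H" and "\<sigma> \<in> H"
    and "\<sigma> \<in> {T (Var p), F (Var p), T (\<sim> Var p), F (\<sim> Var p)}"
  shows "satisfies (eval (hintikka_assignment H)) \<sigma>"
proof -
  have "\<not> (T \<gamma> \<in> H \<and> F \<gamma> \<in> H)" for \<gamma>
    using assms(1) by (simp add: hintikka_def)
  from this[of "Var p"] this[of "\<sim> Var p"] show ?thesis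
    using assms(2,3) by (auto simp: hintikka_assignment_def designated_def)
qed

lemma hintikka_satisfies:
  assumes "hintikka H" and "\<sigma> \<in> H"
  shows "satisfies (eval (hintikka_assignment H)) \<sigma>"
  using assms(2)
proof (induction \<sigma> rule: measure_induct_rule[of sfm_length])
  case (less \<sigma>)
  show ?case
  proof (cases \<sigma> rule: sfm_rule_or_literal_cases)
    case (rule Cs)
    then obtain C where C_in_Cs: "C \<in> set Cs" and C_subset: "C \<subseteq> H"
      using assms(1) less.prems unfolding hintikka_def by blast
    have "satisfies (eval (hintikka_assignment H)) \<tau>" if "\<tau> \<in> C" for \<tau>
    proof (rule less.IH)
      have "conclusion \<sigma> \<tau>"
        using rule C_in_Cs that by (rule conclusionI)
      then show "sfm_length \<tau> < sfm_length \<sigma>"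
        by (rule sfm_length_conclusion)
    qed (use C_subset that in blast)
    then show ?thesis
      using satisfies_tableau_rule_iff[OF valuation_eval rule] C_in_Cs by blast
  next
    case (literal p)
    with assms(1) less.prems show ?thesis
      by (rule hintikka_satisfies_literal)
  qed
qed

section \<open>Closing tableaux\<close>

lemma sub_branch_exists:
  assumes "finite C" and "C \<noteq> {}"
  shows "\<exists>t. sub_branch C t"
  using assms by (induction rule: finite_ne_induct) (blast intro: sub_branch.intros)+

lemma tableau_rule_sub_branches_exist:
  assumes "tableau_rule \<sigma> Cs"
  shows "\<exists>ts. list_all2 sub_branch Cs ts"
proof -
  have "\<forall>C \<in> set Cs. \<exists>t. sub_branch C t"
    using tableau_rule_finite[OF assms] tableau_rule_nonempty(2)[OF assms]
    by (metis sub_branch_exists)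
  then show ?thesis
    by (induction Cs) (auto simp: list_all2_Cons1)
qed

lemma extends_child_rtranclp:
  assumes "(extends (b @ [x]))\<^sup>*\<^sup>* t t'"
  shows "(extends b)\<^sup>*\<^sup>* (Node x (us @ t # vs)) (Node x (us @ t' # vs))"
  using assms
  by (induction rule: rtranclp_induct) (auto intro: rtranclp.rtrancl_into_rtrancl extends.inner)

lemma extends_children_rtranclp:
  assumes "list_all2 (extends (b @ [x]))\<^sup>*\<^sup>* ts ts'"
  shows "(extends b)\<^sup>*\<^sup>* (Node x (us @ ts)) (Node x (us @ ts'))"
  using assms
proof (induction arbitrary: us rule: list_all2_induct)
  case Nil
  then show ?case by simp
next
  case (Cons t ts t' ts')
  have "(extends b)\<^sup>*\<^sup>* (Node x (us @ t # ts)) (Node x (us @ t' # ts))"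
    using Cons.hyps(1) by (rule extends_child_rtranclp)
  also have "(extends b)\<^sup>*\<^sup>* (Node x (us @ t' # ts)) (Node x (us @ t' # ts'))"
    using Cons.IH[of "us @ [t']"] by simp
  finally show ?case .
qed

lemma tableau_extends_rtranclp:
  assumes "(extends [])\<^sup>*\<^sup>* t t'" and "tableau \<eta> t"
  shows "tableau \<eta> t'"
  using assms by (induction rule: rtranclp_induct) (auto intro: tableau.extend)

definition closable :: "'v sfm list \<Rightarrow> 'v sfm tree \<Rightarrow> bool" where
  "closable b t \<longleftrightarrow>
     (\<exists>t'. (extends b)\<^sup>*\<^sup>* t t' \<and> (\<forall>c \<in> branches t'. closed_branch (b @ c)))"

lemma closable_closed_leaf:
  assumes "closed_branch (b @ [x])"
  shows "closable b (Node x [])"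
  unfolding closable_def using assms by (intro exI[of _ "Node x []"]) simp

lemma closable_extends:
  assumes "extends b t t'" and "closable b t'"
  shows "closable b t"
  using assms unfolding closable_def by (meson converse_rtranclp_into_rtranclp)

lemma closable_Node:
  assumes "ts \<noteq> []" and "\<And>t. t \<in> set ts \<Longrightarrow> closable (b @ [x]) t"
  shows "closable b (Node x ts)"
proof -
  obtain f where f_closes: "\<And>t. t \<in> set ts \<Longrightarrow>
      (extends (b @ [x]))\<^sup>*\<^sup>* t (f t) \<and> (\<forall>c \<in> branches (f t). closed_branch ((b @ [x]) @ c))"
    using assms(2) unfolding closable_def by metis
  have "list_all2 (extends (b @ [x]))\<^sup>*\<^sup>* ts (map f ts)"
    using f_closes by (simp add: list_all2_map2 list.rel_refl_strong)
  then have "(extends b)\<^sup>*\<^sup>* (Node x ts) (Node x (map f ts))"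
    using extends_children_rtranclp[where us = "[]"] by (simp only: append_Nil)
  moreover have "\<forall>c \<in> branches (Node x (map f ts)). closed_branch (b @ c)"
    using assms(1) f_closes by auto
  ultimately show ?thesis
    unfolding closable_def by blast
qed

lemma closable_sub_branch:
  assumes "sub_branch C t"
    and "\<And>c y. set (c @ [y]) = set b \<union> C \<Longrightarrow> closable c (Node y [])"
  shows "closable b t"
  using assms
proof (induction arbitrary: b rule: sub_branch.induct)
  case (single x)
  then show ?case by simp
next
  case (step x C t)
  have "closable (b @ [x]) t"
    by (rule step.IH, rule step.prems) simp
  then show ?case
    by (intro closable_Node) auto
qed

lemma closable_tableau_rule:
  assumes "tableau_rule \<sigma> Cs" and "\<sigma> \<in> set (b @ [x])"
    and "\<And>C c y. C \<in> set Cs \<Longrightarrow> set (c @ [y]) = set (b @ [x]) \<union> C \<Longrightarrow> closable c (Node y [])"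
  shows "closable b (Node x [])"
proof (cases "closed_branch (b @ [x])")
  case True
  then show ?thesis by (rule closable_closed_leaf)
next
  case False
  obtain ts where sub_branches: "list_all2 sub_branch Cs ts"
    using tableau_rule_sub_branches_exist[OF assms(1)] ..
  have "closable (b @ [x]) t" if t_in_ts: "t \<in> set ts" for t
  proof -
    obtain C where C_in_Cs: "C \<in> set Cs" and t_sub_branch: "sub_branch C t"
      using sub_branches t_in_ts by (metis in_set_conv_nth list_all2_conv_all_nth)
    from t_sub_branch show ?thesis
      by (rule closable_sub_branch) (rule assms(3)[OF C_in_Cs])
  qed
  moreover have "ts \<noteq> []"
    using sub_branches tableau_rule_nonempty(1)[OF assms(1)] by auto
  ultimately have "closable b (Node x ts)"
    by (rule closable_Node[rotated])
  with extends.leaf[OF False assms(2,1) sub_branches] show ?thesis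
    by (rule closable_extends)
qed

lemma closable_if_not_subset_hintikka:
  assumes "finite S" and "\<And>\<sigma> \<tau>. \<sigma> \<in> S \<Longrightarrow> conclusion \<sigma> \<tau> \<Longrightarrow> \<tau> \<in> S"
    and "set (b @ [x]) \<subseteq> S" and "\<And>H. hintikka H \<Longrightarrow> \<not> set (b @ [x]) \<subseteq> H"
  shows "closable b (Node x [])"
  using assms(3,4)
proof (induction "card (S - set (b @ [x]))" arbitrary: b x rule: less_induct)
  case less
  show ?case
  proof (cases "closed_branch (b @ [x])")
    case True
    then show ?thesis by (rule closable_closed_leaf)
  next
    case False
    moreover have "\<not> hintikka (set (b @ [x]))"
      using less.prems(2) by blast
    ultimately obtain \<sigma> Cs where \<sigma>_on_branch: "\<sigma> \<in> set (b @ [x])" and rule: "tableau_rule \<sigma> Cs"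
        and new: "\<And>C. C \<in> set Cs \<Longrightarrow> \<not> C \<subseteq> set (b @ [x])"
      unfolding hintikka_def closed_branch_def by metis
    from rule \<sigma>_on_branch show ?thesis
    proof (rule closable_tableau_rule)
      fix C c y
      assume C_in_Cs: "C \<in> set Cs" and branch_eq: "set (c @ [y]) = set (b @ [x]) \<union> C"
      have "C \<subseteq> S"
        using assms(2) conclusionI[OF rule C_in_Cs] \<sigma>_on_branch less.prems(1) by blast
      then have "S - set (c @ [y]) \<subset> S - set (b @ [x])"
        using new[OF C_in_Cs] unfolding branch_eq by blast
      then have "card (S - set (c @ [y])) < card (S - set (b @ [x]))"
        by (intro psubset_card_mono finite_Diff assms(1))
      moreover have "set (c @ [y]) \<subseteq> S"
        using \<open>C \<subseteq> S\<close> less.prems(1) unfolding branch_eq by blast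
      moreover have "\<not> set (c @ [y]) \<subseteq> H" if "hintikka H" for H
        using less.prems(2)[OF that] unfolding branch_eq by blast
      ultimately show "closable c (Node y [])"
        by (rule less.hyps)
    qed
  qed
qed

lemma closed_tableau_if_unsatisfiable:
  assumes "\<And>h. valuation h \<Longrightarrow> \<not> satisfies h \<sigma>"
  shows "\<exists>t. tableau \<sigma> t \<and> closed_tableau t"
proof -
  have not_in_hintikka: "\<sigma> \<notin> H" if "hintikka H" for H
    using assms hintikka_satisfies[OF that] valuation_eval by blast
  have "closable [] (Node \<sigma> [])"
  proof (rule closable_if_not_subset_hintikka)
    show "finite {\<tau>. conclusion\<^sup>*\<^sup>* \<sigma> \<tau>}"
      by (rule finite_iterated_conclusions)
  qed (use not_in_hintikka in \<open>auto intro: rtranclp.rtrancl_into_rtrancl\<close>)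
  then obtain t where "(extends [])\<^sup>*\<^sup>* (Node \<sigma> []) t" and "closed_tableau t"
    unfolding closable_def closed_tableau_def by auto
  moreover from this(1) have "tableau \<sigma> t"
    using tableau.root by (rule tableau_extends_rtranclp)
  ultimately show ?thesis by blast
qed

theorem theorem5p8:
  fixes \<alpha> :: "'v fm"
  assumes "\<Turnstile>\<^sub>T\<^sub>M\<^sub>L \<alpha>"
  shows "\<turnstile>\<^sub>T \<alpha>"
proof -
  have "\<not> satisfies h (F \<alpha>)" if "valuation h" for h
    using assms that by (simp add: tml_valid_def designated_def)
  then show ?thesis
    unfolding tableau_provable_def by (rule closed_tableau_if_unsatisfiable)
qed

end
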